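(* Let $(M,g,J)$ be an almost Hermitian manifold, let $\nabla$ be the Levi-Civita connection of $g$ on $M$, let $\nabla^J_XY=-J\nabla_X(JY)$ for $X,Y\in\Gamma(TM)$, and let $\overline{\nabla}=\tfrac12(\nabla+\nabla^J)$ be the first canonical Hermitian connection. If $(M,g,J)$ is nearly K\"ahler, then $d^s_\nabla J=0$ and, in consequence, $$\overline{\nabla}=\nabla-\tfrac14J\circ(d^a_\nabla J)=\nabla-\tfrac18N_J.$$
   Context: An almost Hermitian manifold $(M,g,J)$ is a $2n$-dimensional Riemannian manifold $(M,g)$ with an orthogonal almost complex structure $J:TM\to TM$ (i.e. $J^2=-\mathrm{Id}$, $g(JX,JY)=g(X,Y)$). It is nearly K\"ahler if $(\nabla_XJ)Y=-(\nabla_YJ)X$ for all $X,Y\in\Gamma(TM)$. Here $(\nabla_XJ)Y=\nabla_X(JY)-J\nabla_XY$, and $$(d^a_\nabla J)(X,Y)=(\nabla_XJ)Y-(\nabla_YJ)X,\qquad (d^s_\nabla J)(X,Y)=(\nabla_XJ)Y+(\nabla_YJ)X.$$ The Nijenhuis tensor is normalized as $N_J(X,Y)=J[JX,Y]+J[X,JY]+[X,Y]-[JX,JY]$. The asserted equalities mean $\overline{\nabla}_XY=\nabla_XY-\tfrac14J((d^a_\nabla J)(X,Y))=\nabla_XY-\tfrac18N_J(X,Y)$ for all $X,Y\in\Gamma(TM)$. *)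

theory Defs
  imports "HOL-Analysis.Analysis" "HOL-Library.Function_Algebras"
begin

text \<open>Pointwise real vector space structure on functions; the additive group structure and the
  product of real functions are those of Function_Algebras. Tangent vectors and vector fields are
  represented as functions below, so that they are added and scaled in these structures.\<close>

instantiation "fun" :: (type, real_vector) real_vector
begin

definition scaleR_fun :: "real \<Rightarrow> ('a \<Rightarrow> 'b) \<Rightarrow> 'a \<Rightarrow> 'b"
  where "scaleR_fun c f = (\<lambda>x. c *\<^sub>R f x)"

instance
  by standard (simp_all add: scaleR_fun_def plus_fun_def fun_eq_iff scaleR_add_right scaleR_add_left)

end


section \<open>Smooth functions on open subsets of Euclidean space\<close>

text \<open>As in the library topology \<^term>\<open>Euclidean_space d\<close>, the points of $\mathbb R^d$ are the
  sequences that vanish from index $d$ on; this permits every dimension $d \ge 0$.\<close>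

definition partial_deriv :: "nat \<Rightarrow> ((nat \<Rightarrow> real) \<Rightarrow> real) \<Rightarrow> (nat \<Rightarrow> real) \<Rightarrow> real"
  where "partial_deriv i f x = deriv (\<lambda>t. f (x(i := t))) (x i)"

text \<open>\<open>Ck_on d k V f\<close>: \<open>f\<close> is $C^k$ on \<open>V\<close>, a relatively open subset of $\mathbb R^d$.\<close>

primrec Ck_on :: "nat \<Rightarrow> nat \<Rightarrow> (nat \<Rightarrow> real) set \<Rightarrow> ((nat \<Rightarrow> real) \<Rightarrow> real) \<Rightarrow> bool"
where
  "Ck_on d 0 V f \<longleftrightarrow> continuous_map (subtopology (Euclidean_space d) V) euclideanreal f"
| "Ck_on d (Suc k) V f \<longleftrightarrow>
     continuous_map (subtopology (Euclidean_space d) V) euclideanreal f \<and>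
     (\<forall>i<d. (\<forall>x\<in>V. (\<lambda>t. f (x(i := t))) field_differentiable (at (x i))) \<and>
            Ck_on d k V (partial_deriv i f))"

definition smooth_on :: "nat \<Rightarrow> (nat \<Rightarrow> real) set \<Rightarrow> ((nat \<Rightarrow> real) \<Rightarrow> real) \<Rightarrow> bool"
  where "smooth_on d V f \<longleftrightarrow> (\<forall>k. Ck_on d k V f)"


section \<open>Smooth manifolds\<close>

text \<open>The atlas need not be maximal; any smooth atlas determines the smooth structure.\<close>

record 'a manifold =
  top_of :: "'a topology"
  dim_of :: nat
  atlas_of :: "('a set \<times> ('a \<Rightarrow> nat \<Rightarrow> real)) set"

definition points :: "'a manifold \<Rightarrow> 'a set"
  where "points M = topspace (top_of M)"

definition chart :: "'a manifold \<Rightarrow> 'a set \<Rightarrow> ('a \<Rightarrow> nat \<Rightarrow> real) \<Rightarrow> bool"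
  where "chart M U \<phi> \<longleftrightarrow>
    openin (top_of M) U \<and> openin (Euclidean_space (dim_of M)) (\<phi> ` U) \<and>
    homeomorphic_map (subtopology (top_of M) U)
      (subtopology (Euclidean_space (dim_of M)) (\<phi> ` U)) \<phi>"

definition smooth_manifold :: "'a manifold \<Rightarrow> bool"
  where "smooth_manifold M \<longleftrightarrow>
    Hausdorff_space (top_of M) \<and> second_countable (top_of M) \<and>
    (\<forall>(U, \<phi>) \<in> atlas_of M. chart M U \<phi>) \<and>
    (\<Union>(U, \<phi>) \<in> atlas_of M. U) = points M \<and>
    (\<forall>(U, \<phi>) \<in> atlas_of M. \<forall>(V, \<psi>) \<in> atlas_of M. \<forall>i < dim_of M.
       smooth_on (dim_of M) (\<phi> ` (U \<inter> V)) (\<lambda>x. \<psi> (inv_into U \<phi> x) i))"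

text \<open>Smooth real functions, extended by zero off \<^term>\<open>points M\<close> so that functions on the
  manifold are equal as soon as they agree on its points. Likewise below, a tangent vector is
  zero on functions that are not smooth, and a vector field is zero off the manifold.\<close>

definition smooth_functions :: "'a manifold \<Rightarrow> ('a \<Rightarrow> real) set"
  where "smooth_functions M =
    {f. (\<forall>p. p \<notin> points M \<longrightarrow> f p = 0) \<and>
        (\<forall>(U, \<phi>) \<in> atlas_of M. smooth_on (dim_of M) (\<phi> ` U) (\<lambda>x. f (inv_into U \<phi> x)))}"

type_synonym 'a tangent_vector = "('a \<Rightarrow> real) \<Rightarrow> real"
type_synonym 'a vector_field = "'a \<Rightarrow> 'a tangent_vector"

text \<open>Tangent vectors at \<open>p\<close> are the derivations at \<open>p\<close> of the algebra of smooth functions.\<close>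

definition tangent_space :: "'a manifold \<Rightarrow> 'a \<Rightarrow> 'a tangent_vector set"
  where "tangent_space M p =
    {v. (\<forall>f. f \<notin> smooth_functions M \<longrightarrow> v f = 0) \<and>
        (\<forall>f \<in> smooth_functions M. \<forall>h \<in> smooth_functions M. v (f + h) = v f + v h) \<and>
        (\<forall>c. \<forall>f \<in> smooth_functions M. v (c *\<^sub>R f) = c * v f) \<and>
        (\<forall>f \<in> smooth_functions M. \<forall>h \<in> smooth_functions M. v (f * h) = f p * v h + h p * v f)}"

definition vf_apply :: "'a vector_field \<Rightarrow> ('a \<Rightarrow> real) \<Rightarrow> 'a \<Rightarrow> real"
  where "vf_apply X f = (\<lambda>p. X p f)"

definition vf_mult :: "('a \<Rightarrow> real) \<Rightarrow> 'a vector_field \<Rightarrow> 'a vector_field"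
  where "vf_mult f X = (\<lambda>p. f p *\<^sub>R X p)"

definition vector_fields :: "'a manifold \<Rightarrow> 'a vector_field set"
  where "vector_fields M =
    {X. (\<forall>p \<in> points M. X p \<in> tangent_space M p) \<and> (\<forall>p. p \<notin> points M \<longrightarrow> X p = 0) \<and>
        (\<forall>f \<in> smooth_functions M. vf_apply X f \<in> smooth_functions M)}"

definition lie_bracket :: "'a vector_field \<Rightarrow> 'a vector_field \<Rightarrow> 'a vector_field"
  where "lie_bracket X Y = (\<lambda>p f. X p (vf_apply Y f) - Y p (vf_apply X f))"


section \<open>Riemannian metrics and the Levi-Civita connection\<close>

text \<open>Smoothness of the tensor fields \<open>g\<close> and \<open>J\<close> is tested on smooth vector fields; by bump
  functions this agrees with smoothness of their components in charts.\<close>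

type_synonym 'a metric = "'a \<Rightarrow> 'a tangent_vector \<Rightarrow> 'a tangent_vector \<Rightarrow> real"

definition pairing ::
    "'a manifold \<Rightarrow> 'a metric \<Rightarrow> 'a vector_field \<Rightarrow> 'a vector_field \<Rightarrow> 'a \<Rightarrow> real"
  where "pairing M g X Y = (\<lambda>p. if p \<in> points M then g p (X p) (Y p) else 0)"

definition riemannian_metric :: "'a manifold \<Rightarrow> 'a metric \<Rightarrow> bool"
  where "riemannian_metric M g \<longleftrightarrow>
    (\<forall>p \<in> points M.
       (\<forall>u \<in> tangent_space M p. \<forall>v \<in> tangent_space M p. g p u v = g p v u) \<and>
       (\<forall>u \<in> tangent_space M p. \<forall>v \<in> tangent_space M p. \<forall>w \<in> tangent_space M p.
          g p (u + v) w = g p u w + g p v w) \<and>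
       (\<forall>c. \<forall>u \<in> tangent_space M p. \<forall>v \<in> tangent_space M p. g p (c *\<^sub>R u) v = c * g p u v) \<and>
       (\<forall>u \<in> tangent_space M p. u \<noteq> 0 \<longrightarrow> g p u u > 0)) \<and>
    (\<forall>X \<in> vector_fields M. \<forall>Y \<in> vector_fields M. pairing M g X Y \<in> smooth_functions M)"

type_synonym 'a connection = "'a vector_field \<Rightarrow> 'a vector_field \<Rightarrow> 'a vector_field"

text \<open>\<^term>\<open>nabla X Y\<close> is $\nabla_X Y$.\<close>

definition affine_connection :: "'a manifold \<Rightarrow> 'a connection \<Rightarrow> bool"
  where "affine_connection M nabla \<longleftrightarrow>
    (\<forall>X \<in> vector_fields M. \<forall>Y \<in> vector_fields M. nabla X Y \<in> vector_fields M) \<and>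
    (\<forall>X \<in> vector_fields M. \<forall>X' \<in> vector_fields M. \<forall>Y \<in> vector_fields M.
       nabla (X + X') Y = nabla X Y + nabla X' Y) \<and>
    (\<forall>f \<in> smooth_functions M. \<forall>X \<in> vector_fields M. \<forall>Y \<in> vector_fields M.
       nabla (vf_mult f X) Y = vf_mult f (nabla X Y)) \<and>
    (\<forall>X \<in> vector_fields M. \<forall>Y \<in> vector_fields M. \<forall>Y' \<in> vector_fields M.
       nabla X (Y + Y') = nabla X Y + nabla X Y') \<and>
    (\<forall>c. \<forall>X \<in> vector_fields M. \<forall>Y \<in> vector_fields M. nabla X (c *\<^sub>R Y) = c *\<^sub>R nabla X Y) \<and>
    (\<forall>f \<in> smooth_functions M. \<forall>X \<in> vector_fields M. \<forall>Y \<in> vector_fields M.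
       nabla X (vf_mult f Y) = vf_mult f (nabla X Y) + vf_mult (vf_apply X f) Y)"

definition torsion_free :: "'a manifold \<Rightarrow> 'a connection \<Rightarrow> bool"
  where "torsion_free M nabla \<longleftrightarrow>
    (\<forall>X \<in> vector_fields M. \<forall>Y \<in> vector_fields M. nabla X Y - nabla Y X = lie_bracket X Y)"

definition metric_compatible :: "'a manifold \<Rightarrow> 'a metric \<Rightarrow> 'a connection \<Rightarrow> bool"
  where "metric_compatible M g nabla \<longleftrightarrow>
    (\<forall>X \<in> vector_fields M. \<forall>Y \<in> vector_fields M. \<forall>Z \<in> vector_fields M.
       vf_apply X (pairing M g Y Z) = pairing M g (nabla X Y) Z + pairing M g Y (nabla X Z))"

definition levi_civita :: "'a manifold \<Rightarrow> 'a metric \<Rightarrow> 'a connection \<Rightarrow> bool"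
  where "levi_civita M g nabla \<longleftrightarrow>
    affine_connection M nabla \<and> torsion_free M nabla \<and> metric_compatible M g nabla"


section \<open>Almost Hermitian manifolds\<close>

type_synonym 'a endomorphism_field = "'a \<Rightarrow> 'a tangent_vector \<Rightarrow> 'a tangent_vector"

definition endo_apply ::
    "'a manifold \<Rightarrow> 'a endomorphism_field \<Rightarrow> 'a vector_field \<Rightarrow> 'a vector_field"
  where "endo_apply M J X = (\<lambda>p. if p \<in> points M then J p (X p) else 0)"

definition almost_complex_structure :: "'a manifold \<Rightarrow> 'a endomorphism_field \<Rightarrow> bool"
  where "almost_complex_structure M J \<longleftrightarrow>
    (\<forall>p \<in> points M.
       (\<forall>v \<in> tangent_space M p. J p v \<in> tangent_space M p) \<and>
       (\<forall>u \<in> tangent_space M p. \<forall>v \<in> tangent_space M p. J p (u + v) = J p u + J p v) \<and>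
       (\<forall>c. \<forall>v \<in> tangent_space M p. J p (c *\<^sub>R v) = c *\<^sub>R J p v) \<and>
       (\<forall>v \<in> tangent_space M p. J p (J p v) = - v)) \<and>
    (\<forall>X \<in> vector_fields M. endo_apply M J X \<in> vector_fields M)"

definition almost_hermitian :: "'a manifold \<Rightarrow> 'a metric \<Rightarrow> 'a endomorphism_field \<Rightarrow> bool"
  where "almost_hermitian M g J \<longleftrightarrow>
    smooth_manifold M \<and> even (dim_of M) \<and> riemannian_metric M g \<and>
    almost_complex_structure M J \<and>
    (\<forall>p \<in> points M. \<forall>u \<in> tangent_space M p. \<forall>v \<in> tangent_space M p.
       g p (J p u) (J p v) = g p u v)"

text \<open>$(\nabla_X J)Y$, $(d^a_\nabla J)(X,Y)$ and $(d^s_\nabla J)(X,Y)$:\<close>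

definition cov_deriv ::
    "'a manifold \<Rightarrow> 'a connection \<Rightarrow> 'a endomorphism_field \<Rightarrow> 'a connection"
  where "cov_deriv M nabla J X Y = nabla X (endo_apply M J Y) - endo_apply M J (nabla X Y)"

definition d_alt ::
    "'a manifold \<Rightarrow> 'a connection \<Rightarrow> 'a endomorphism_field \<Rightarrow> 'a connection"
  where "d_alt M nabla J X Y = cov_deriv M nabla J X Y - cov_deriv M nabla J Y X"

definition d_sym ::
    "'a manifold \<Rightarrow> 'a connection \<Rightarrow> 'a endomorphism_field \<Rightarrow> 'a connection"
  where "d_sym M nabla J X Y = cov_deriv M nabla J X Y + cov_deriv M nabla J Y X"

text \<open>The connection quantified here is the unique Levi-Civita connection of \<open>g\<close>.\<close>

definition nearly_kahler ::
    "'a manifold \<Rightarrow> 'a metric \<Rightarrow> 'a endomorphism_field \<Rightarrow> bool"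
  where "nearly_kahler M g J \<longleftrightarrow>
    almost_hermitian M g J \<and>
    (\<forall>nabla. levi_civita M g nabla \<longrightarrow>
      (\<forall>X \<in> vector_fields M. \<forall>Y \<in> vector_fields M.
         cov_deriv M nabla J X Y = - cov_deriv M nabla J Y X))"

definition nijenhuis ::
    "'a manifold \<Rightarrow> 'a endomorphism_field \<Rightarrow> 'a vector_field \<Rightarrow> 'a vector_field \<Rightarrow> 'a vector_field"
  where "nijenhuis M J X Y =
    endo_apply M J (lie_bracket (endo_apply M J X) Y)
    + endo_apply M J (lie_bracket X (endo_apply M J Y))
    + lie_bracket X Y - lie_bracket (endo_apply M J X) (endo_apply M J Y)"

definition conjugate_connection ::
    "'a manifold \<Rightarrow> 'a endomorphism_field \<Rightarrow> 'a connection \<Rightarrow> 'a connection"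
  where "conjugate_connection M J nabla X Y = - endo_apply M J (nabla X (endo_apply M J Y))"

definition first_canonical ::
    "'a manifold \<Rightarrow> 'a endomorphism_field \<Rightarrow> 'a connection \<Rightarrow> 'a connection"
  where "first_canonical M J nabla X Y =
    (1/2) *\<^sub>R (nabla X Y + conjugate_connection M J nabla X Y)"

end

theory Submission
  imports Defs
begin

text \<open>Write \<open>A X Y\<close> for \<open>cov_deriv M nabla J X Y\<close>, that is $(\nabla_X J)Y$. Differentiating
  $J^2 = -1$ along $X$ shows that $\nabla_X J$ anticommutes with $J$, that is
  $A(X, JY) = -J A(X, Y)$ (\<open>cov_deriv_endo_anticommute\<close>).
  Expanding $J A(X,Y) = J\nabla_X(JY) + \nabla_X Y$ gives
  $\overline\nabla_X Y = \nabla_X Y - \frac12 J A(X, Y)$ (\<open>first_canonical_eq\<close>); both hold for every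
  affine connection. If the connection has no torsion, brackets can be replaced by covariant
  derivatives, and those in the Nijenhuis tensor combine into derivatives of $J$:
  \[ N_J(X,Y) = J A(X,Y) - J A(Y,X) - A(JX,Y) + A(JY,X) \]
  (\<open>nijenhuis_eq_cov_deriv\<close>). On a nearly Kaehler manifold $A$ is skew, so $d^s_\nabla J = 0$ and
  $d^a_\nabla J = 2A$. Skewness also moves the $J$ in the last two terms of $N_J$ into the second slot,
  where it anticommutes out, so that each of the four terms is $J A(X,Y)$ and $N_J = 4 J A$.
  All three connections are thus $\nabla - \frac12 J A$.\<close>

text \<open>Linearity of \<open>J\<close> is a pointwise matter and is available only on tangent vectors. Sections
  without a smoothness condition are a space on which it can be used freely, without verifying that
  linear combinations of smooth fields are smooth.\<close>

definition tangent_sections :: "'a manifold \<Rightarrow> 'a vector_field set"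
  where "tangent_sections M =
    {X. (\<forall>p \<in> points M. X p \<in> tangent_space M p) \<and> (\<forall>p. p \<notin> points M \<longrightarrow> X p = 0)}"

lemma tangent_space_scaleR:
  "v \<in> tangent_space M p \<Longrightarrow> c *\<^sub>R v \<in> tangent_space M p"
  by (simp add: tangent_space_def scaleR_fun_def algebra_simps)

lemma tangent_space_add:
  "u \<in> tangent_space M p \<Longrightarrow> v \<in> tangent_space M p \<Longrightarrow> u + v \<in> tangent_space M p"
  by (simp add: tangent_space_def algebra_simps)

lemma tangent_sections_scaleR:
  "X \<in> tangent_sections M \<Longrightarrow> c *\<^sub>R X \<in> tangent_sections M"
  by (simp add: tangent_sections_def scaleR_fun_def[of c X] tangent_space_scaleR)

lemma tangent_sections_add:
  "X \<in> tangent_sections M \<Longrightarrow> Y \<in> tangent_sections M \<Longrightarrow> X + Y \<in> tangent_sections M"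
  by (simp add: tangent_sections_def plus_fun_apply[of X Y] tangent_space_add)

lemma tangent_sections_diff:
  assumes "X \<in> tangent_sections M" "Y \<in> tangent_sections M"
  shows "X - Y \<in> tangent_sections M"
  using tangent_sections_add[OF assms(1) tangent_sections_scaleR[OF assms(2), of "-1"]] by simp

lemma vector_field_tangent_section: "X \<in> vector_fields M \<Longrightarrow> X \<in> tangent_sections M"
  by (simp add: vector_fields_def tangent_sections_def)

lemma endo_apply_vector_field:
  "almost_complex_structure M J \<Longrightarrow> X \<in> vector_fields M \<Longrightarrow> endo_apply M J X \<in> vector_fields M"
  by (simp add: almost_complex_structure_def)

lemma endo_apply_tangent_section:
  "almost_complex_structure M J \<Longrightarrow> X \<in> tangent_sections M \<Longrightarrow>
    endo_apply M J X \<in> tangent_sections M"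
  by (simp add: almost_complex_structure_def tangent_sections_def endo_apply_def)

lemma endo_apply_add:
  assumes "almost_complex_structure M J" "X \<in> tangent_sections M" "Y \<in> tangent_sections M"
  shows "endo_apply M J (X + Y) = endo_apply M J X + endo_apply M J Y"
  using assms by (intro ext) (auto simp: almost_complex_structure_def tangent_sections_def endo_apply_def)

lemma endo_apply_scaleR:
  assumes "almost_complex_structure M J" "X \<in> tangent_sections M"
  shows "endo_apply M J (c *\<^sub>R X) = c *\<^sub>R endo_apply M J X"
  using assms
  by (intro ext) (auto simp: almost_complex_structure_def tangent_sections_def endo_apply_def
      scaleR_fun_def[of c X] scaleR_fun_def)

lemma endo_apply_diff:
  assumes "almost_complex_structure M J" "X \<in> tangent_sections M" "Y \<in> tangent_sections M"
  shows "endo_apply M J (X - Y) = endo_apply M J X - endo_apply M J Y"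
  using endo_apply_add[OF assms(1,2) tangent_sections_scaleR[OF assms(3), of "-1"]]
    endo_apply_scaleR[OF assms(1,3), of "-1"] by simp

lemma endo_apply_twice:
  assumes "almost_complex_structure M J" "X \<in> tangent_sections M"
  shows "endo_apply M J (endo_apply M J X) = - X"
  using assms by (intro ext) (auto simp: almost_complex_structure_def tangent_sections_def endo_apply_def)

lemma connection_vector_field:
  "affine_connection M nabla \<Longrightarrow> X \<in> vector_fields M \<Longrightarrow> Y \<in> vector_fields M \<Longrightarrow>
    nabla X Y \<in> vector_fields M"
  by (simp add: affine_connection_def)

lemma connection_uminus:
  assumes "affine_connection M nabla" "X \<in> vector_fields M" "Y \<in> vector_fields M"
  shows "nabla X (- Y) = - nabla X Y"
proof -
  have "nabla X ((-1) *\<^sub>R Y) = (-1) *\<^sub>R nabla X Y"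
    using assms unfolding affine_connection_def by blast
  then show ?thesis by simp
qed

lemma cov_deriv_tangent_section:
  assumes "almost_complex_structure M J" "affine_connection M nabla"
    and "X \<in> vector_fields M" "Y \<in> vector_fields M"
  shows "cov_deriv M nabla J X Y \<in> tangent_sections M"
  using assms
  by (simp add: cov_deriv_def tangent_sections_diff endo_apply_tangent_section
      vector_field_tangent_section connection_vector_field endo_apply_vector_field)

lemma endo_cov_deriv:
  assumes "almost_complex_structure M J" "affine_connection M nabla"
    and "X \<in> vector_fields M" "Y \<in> vector_fields M"
  shows "endo_apply M J (cov_deriv M nabla J X Y) = endo_apply M J (nabla X (endo_apply M J Y)) + nabla X Y"
  using assms
  by (simp add: cov_deriv_def endo_apply_diff endo_apply_twice endo_apply_tangent_section
      vector_field_tangent_section connection_vector_field endo_apply_vector_field)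

text \<open>The Leibniz rule for $J^2 = -1$: $(\nabla_X J)J + J(\nabla_X J) = 0$.\<close>

lemma cov_deriv_endo_anticommute:
  assumes "almost_complex_structure M J" "affine_connection M nabla"
    and "X \<in> vector_fields M" "Y \<in> vector_fields M"
  shows "cov_deriv M nabla J X (endo_apply M J Y) = - endo_apply M J (cov_deriv M nabla J X Y)"
proof -
  have "cov_deriv M nabla J X (endo_apply M J Y)
      = nabla X (- Y) - endo_apply M J (nabla X (endo_apply M J Y))"
    unfolding cov_deriv_def endo_apply_twice[OF assms(1) vector_field_tangent_section[OF assms(4)]] ..
  also have "\<dots> = - nabla X Y - endo_apply M J (nabla X (endo_apply M J Y))"
    unfolding connection_uminus[OF assms(2-4)] ..
  also have "\<dots> = - endo_apply M J (cov_deriv M nabla J X Y)"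
    unfolding endo_cov_deriv[OF assms] by (simp only: minus_add_distrib diff_conv_add_uminus add.commute)
  finally show ?thesis .
qed

lemma first_canonical_eq:
  assumes "almost_complex_structure M J" "affine_connection M nabla"
    and "X \<in> vector_fields M" "Y \<in> vector_fields M"
  shows "first_canonical M J nabla X Y
    = nabla X Y - (1/2) *\<^sub>R endo_apply M J (cov_deriv M nabla J X Y)"
proof -
  have "nabla X Y = (1/2) *\<^sub>R nabla X Y + (1/2) *\<^sub>R nabla X Y"
    by (simp flip: scaleR_left_distrib)
  then show ?thesis
    unfolding first_canonical_def conjugate_connection_def endo_cov_deriv[OF assms]
    by (simp add: scaleR_right_distrib scaleR_right_diff_distrib algebra_simps)
qed

text \<open>Each bracket is a difference of two covariant derivatives. In the resulting eight terms the
  derivatives along any one of $X$, $Y$, $JX$, $JY$ form a pair, and each pair is a value of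
  $\nabla J$, composed with $J$ in the directions $X$ and $Y$.\<close>

lemma nijenhuis_eq_cov_deriv:
  assumes J: "almost_complex_structure M J" and nabla: "affine_connection M nabla"
    and torsion: "torsion_free M nabla"
    and X: "X \<in> vector_fields M" and Y: "Y \<in> vector_fields M"
  shows "nijenhuis M J X Y =
    endo_apply M J (cov_deriv M nabla J X Y) - endo_apply M J (cov_deriv M nabla J Y X)
    - cov_deriv M nabla J (endo_apply M J X) Y + cov_deriv M nabla J (endo_apply M J Y) X"
proof -
  have bracket: "lie_bracket V W = nabla V W - nabla W V"
    if "V \<in> vector_fields M" "W \<in> vector_fields M" for V W
    using torsion that by (simp add: torsion_free_def)
  note closed = vector_field_tangent_section connection_vector_field[OF nabla]
    endo_apply_vector_field[OF J]
  show ?thesis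
    unfolding nijenhuis_def endo_cov_deriv[OF J nabla X Y] endo_cov_deriv[OF J nabla Y X]
    using X Y by (simp add: bracket closed endo_apply_diff[OF J] cov_deriv_def)
qed

text \<open>Skewness and anticommutation together give
  $-A(JX,Y) = A(Y,JX) = -J A(Y,X) = J A(X,Y)$ and $A(JY,X) = -A(X,JY) = J A(X,Y)$.\<close>

lemma nijenhuis_nearly_kahler:
  assumes J: "almost_complex_structure M J" and nabla: "affine_connection M nabla"
    and torsion: "torsion_free M nabla"
    and skew: "\<And>V W. V \<in> vector_fields M \<Longrightarrow> W \<in> vector_fields M \<Longrightarrow>
      cov_deriv M nabla J V W = - cov_deriv M nabla J W V"
    and X: "X \<in> vector_fields M" and Y: "Y \<in> vector_fields M"
  shows "nijenhuis M J X Y = 4 *\<^sub>R endo_apply M J (cov_deriv M nabla J X Y)"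
proof -
  let ?A = "cov_deriv M nabla J" and ?E = "endo_apply M J"
  have swap: "?E (?A Y X) = - ?E (?A X Y)"
    using endo_apply_scaleR[OF J cov_deriv_tangent_section[OF J nabla X Y], of "-1"] skew[OF Y X]
    by simp
  have "?A (?E X) Y = - ?E (?A X Y)"
    using skew[OF endo_apply_vector_field[OF J X] Y] cov_deriv_endo_anticommute[OF J nabla Y X] swap
    by simp
  moreover have "?A (?E Y) X = ?E (?A X Y)"
    using skew[OF endo_apply_vector_field[OF J Y] X] cov_deriv_endo_anticommute[OF J nabla X Y]
    by simp
  moreover have "(4::real) *\<^sub>R V = V + V + V + V" for V :: "'a vector_field"
    using scaleR_left_distrib[of 2 2 V] by (simp add: scaleR_2 add.assoc)
  ultimately show ?thesis
    unfolding nijenhuis_eq_cov_deriv[OF J nabla torsion X Y] swap by simp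
qed

theorem corollary6p11:
  fixes M :: "'a manifold" and g :: "'a metric" and J :: "'a endomorphism_field"
    and nabla :: "'a connection"
  assumes "almost_hermitian M g J"
    and "levi_civita M g nabla"
    and "nearly_kahler M g J"
  shows "(\<forall>X \<in> vector_fields M. \<forall>Y \<in> vector_fields M. d_sym M nabla J X Y = 0) \<and>
    (\<forall>X \<in> vector_fields M. \<forall>Y \<in> vector_fields M.
       first_canonical M J nabla X Y
         = nabla X Y - (1/4) *\<^sub>R endo_apply M J (d_alt M nabla J X Y) \<and>
       nabla X Y - (1/4) *\<^sub>R endo_apply M J (d_alt M nabla J X Y)
         = nabla X Y - (1/8) *\<^sub>R nijenhuis M J X Y)"
proof -
  have J: "almost_complex_structure M J"
    using assms(1) by (simp add: almost_hermitian_def)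
  have nabla: "affine_connection M nabla" and torsion: "torsion_free M nabla"
    using assms(2) by (simp_all add: levi_civita_def)
  have skew: "cov_deriv M nabla J V W = - cov_deriv M nabla J W V"
    if "V \<in> vector_fields M" "W \<in> vector_fields M" for V W
    using assms(2,3) that unfolding nearly_kahler_def by blast
  have "d_sym M nabla J X Y = 0" if "X \<in> vector_fields M" "Y \<in> vector_fields M" for X Y
    using skew[OF that] by (simp add: d_sym_def)
  moreover have "endo_apply M J (d_alt M nabla J X Y)
      = 2 *\<^sub>R endo_apply M J (cov_deriv M nabla J X Y)"
    if X: "X \<in> vector_fields M" and Y: "Y \<in> vector_fields M" for X Y
  proof -
    have "d_alt M nabla J X Y = 2 *\<^sub>R cov_deriv M nabla J X Y"
      using skew[OF Y X] by (simp add: d_alt_def scaleR_2)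
    then show ?thesis
      by (simp add: endo_apply_scaleR[OF J cov_deriv_tangent_section[OF J nabla X Y]])
  qed
  ultimately show ?thesis
    by (simp add: first_canonical_eq[OF J nabla] nijenhuis_nearly_kahler[OF J nabla torsion skew])
qed

end
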